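(* Let $\mu\ge0$, $0\le\rho<1$, and let $f(z)=z+\sum_{m=2}^{\infty}a_m z^m+\overline{\sum_{m=2}^{\infty}b_m z^m}\in W^0_{\mathcal{H}}(\mu,\rho)$. Then $$|z|+\sum_{m=2}^\infty(|a_m|+|b_m|)|z|^m\le d(f(0),\partial f(\mathbb{D}))$$ for $|z|\le r^*$, where $r^*$ is the unique positive root in $(0,1)$ of $$r+\sum_{m=2}^\infty\frac{2(1-\rho)}{m(1+\mu(m-1))}r^m=1-2\sum_{m=2}^\infty\frac{(-1)^{m-1}(1-\rho)}{m(1+\mu(m-1))}.$$ The radius $r^*$ is the Bohr radius for the class $W^0_{\mathcal{H}}(\mu,\rho)$.
   Context: $\mathbb{D}=\{z\in\mathbb{C}:|z|<1\}$; $d(f(0),\partial f(\mathbb{D}))$ is the Euclidean distance from $f(0)$ to the boundary of $f(\mathbb{D})$. $\mathcal{H}_0$ is the class of complex-valued harmonic functions $f=h+\bar g$ on $\mathbb{D}$ with $h(z)=z+\sum_{m=2}^\infty a_mz^m$ and $g(z)=\sum_{m=2}^\infty b_mz^m$ analytic in $\mathbb{D}$. $W^0_{\mathcal{H}}(\mu,\rho)$ is the class of $f=h+\bar g\in\mathcal{H}_0$ with $\Re(h'(z)+\mu zh''(z)-\rho)>|g'(z)+\mu zg''(z)|$ for all $z\in\mathbb{D}$. The Bohr radius of the class is the largest $r^*\in(0,1]$ such that the first displayed inequality holds for all $|z|=r\le r^*$ and all members of the class.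
   Formalization: The sign before the series on the right of the equation for r* is changed from minus to plus: as printed the right side exceeds 1, while the extremal function of the class has d(f(0),∂f(D)) < 1, so the printed claim fails for all μ and ρ. *)

theory Defs
  imports "HOL-Complex_Analysis.Complex_Analysis"
begin

abbreviation unit_disk :: "complex set" where
  "unit_disk \<equiv> ball 0 1"

text \<open>
  A harmonic function \<open>f = h + cnj g\<close> on the unit disk, normalised so that
  \<open>h z = z + (\<Sum>m\<ge>2. a m * z^m)\<close> and \<open>g z = (\<Sum>m\<ge>2. b m * z^m)\<close>. Only the values of
  \<open>f\<close>, \<open>h\<close>, \<open>g\<close> on the disk and of \<open>a m\<close>, \<open>b m\<close> for \<open>m \<ge> 2\<close> are constrained.
\<close>

definition H0_decomposition ::
  "(complex \<Rightarrow> complex) \<Rightarrow> (complex \<Rightarrow> complex) \<Rightarrow> (complex \<Rightarrow> complex)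
    \<Rightarrow> (nat \<Rightarrow> complex) \<Rightarrow> (nat \<Rightarrow> complex) \<Rightarrow> bool" where
  "H0_decomposition f h g a b \<longleftrightarrow>
     h holomorphic_on unit_disk \<and> g holomorphic_on unit_disk \<and>
     (\<forall>z\<in>unit_disk. f z = h z + cnj (g z)
        \<and> (\<lambda>m. a (m + 2) * z ^ (m + 2)) sums (h z - z)
        \<and> (\<lambda>m. b (m + 2) * z ^ (m + 2)) sums g z)"

definition H0_coefficients ::
  "(complex \<Rightarrow> complex) \<Rightarrow> (nat \<Rightarrow> complex) \<Rightarrow> (nat \<Rightarrow> complex) \<Rightarrow> bool" where
  "H0_coefficients f a b \<longleftrightarrow> (\<exists>h g. H0_decomposition f h g a b)"

definition W0H :: "real \<Rightarrow> real \<Rightarrow> (complex \<Rightarrow> complex) set" where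
  "W0H \<mu> \<rho> = {f. \<exists>h g a b. H0_decomposition f h g a b \<and>
     (\<forall>z\<in>unit_disk.
        Re (deriv h z + of_real \<mu> * z * deriv (deriv h) z - of_real \<rho>)
          > cmod (deriv g z + of_real \<mu> * z * deriv (deriv g) z))}"

text \<open>
  Since \<open>suminf\<close> is unspecified on divergent series, convergence is part of the inequality.
  This only matters for \<open>cmod z \<ge> 1\<close>.
\<close>

definition bohr_inequality ::
  "(complex \<Rightarrow> complex) \<Rightarrow> (nat \<Rightarrow> complex) \<Rightarrow> (nat \<Rightarrow> complex) \<Rightarrow> complex \<Rightarrow> bool" where
  "bohr_inequality f a b z \<longleftrightarrow>
     summable (\<lambda>m. (cmod (a (m + 2)) + cmod (b (m + 2))) * cmod z ^ (m + 2)) \<and>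
     cmod z + (\<Sum>m. (cmod (a (m + 2)) + cmod (b (m + 2))) * cmod z ^ (m + 2))
       \<le> infdist (f 0) (frontier (f ` unit_disk))"

definition bohr_inequality_upto :: "(complex \<Rightarrow> complex) set \<Rightarrow> real \<Rightarrow> bool" where
  "bohr_inequality_upto F R \<longleftrightarrow>
     (\<forall>f\<in>F. \<forall>a b z. H0_coefficients f a b \<longrightarrow> cmod z \<le> R \<longrightarrow> bohr_inequality f a b z)"

definition is_bohr_radius :: "(complex \<Rightarrow> complex) set \<Rightarrow> real \<Rightarrow> bool" where
  "is_bohr_radius F R \<longleftrightarrow>
     R \<in> {0<..1} \<and> bohr_inequality_upto F R \<and>
     (\<forall>R'\<in>{0<..1}. bohr_inequality_upto F R' \<longrightarrow> R' \<le> R)"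

text \<open>
  The equation for the radius. Its right-hand side is \<open>- h (-1)\<close> for the extremal function
  \<open>h z = z + (\<Sum>m\<ge>2. 2 * (1 - \<rho>) / (m * (1 + \<mu> * (m - 1))) * z^m)\<close>, so the series enters with
  a plus sign. The source prints a minus sign. This is a misprint: the right-hand side
  would then exceed \<open>1\<close>, while the distance from \<open>h 0\<close> to the boundary of the image is
  \<open>- h (-1) < 1\<close>. At \<open>\<mu> = 0\<close> the right-hand series converges only
  conditionally; \<open>suminf\<close> sums it in the natural order.
\<close>

definition bohr_equation :: "real \<Rightarrow> real \<Rightarrow> real \<Rightarrow> bool" where
  "bohr_equation \<mu> \<rho> r \<longleftrightarrow>
     r + (\<Sum>m. 2 * (1 - \<rho>) / (real (m + 2) * (1 + \<mu> * (real (m + 2) - 1))) * r ^ (m + 2))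
     = 1 + 2 * (\<Sum>m. (-1) ^ (m + 2 - 1) * (1 - \<rho>) / (real (m + 2) * (1 + \<mu> * (real (m + 2) - 1))))"

end

theory Submission
  imports Defs
begin

text \<open>
  For \<open>\<bar>\<epsilon>\<bar> = 1\<close> the analytic function \<open>F = h + \<epsilon> g\<close> has \<open>Re (F' + \<mu> z F'') > \<rho>\<close>.
  Caratheodory's inequality applied to \<open>F' + \<mu> z F''\<close>, with \<open>\<epsilon>\<close> aligning the two coefficients,
  bounds \<open>\<bar>a m\<bar> + \<bar>b m\<bar>\<close>. Harnack's inequality for the same function, pulled back along radii
  through the Euler operator \<open>u + \<mu> r u'\<close>, gives \<open>\<bar>f z\<bar> \<ge> - E (- \<bar>z\<bar>)\<close> for the extremal function
  \<open>E\<close>, and \<open>Re F' > 0\<close>, so that \<open>f\<close> is injective, hence open. Boundary points of the image are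
  therefore limits along \<open>\<bar>z\<bar> \<rightarrow> 1\<close>, and their modulus is at least \<open>- E (-1)\<close>, the right-hand
  side of the equation. The value \<open>E (-1)\<close> is itself a boundary point of the image of \<open>E\<close>, which
  makes the radius sharp.
\<close>

section \<open>Functions with positive real part and the Euler operator\<close>

text \<open>Stated for a function that is given pointwise by its series, so that it can be applied a
  second time to \<open>deriv f\<close>.\<close>

lemma deriv_power_series:
  fixes c :: "nat \<Rightarrow> complex"
  assumes "\<And>z. cmod z < 1 \<Longrightarrow> (\<lambda>n. c n * z ^ n) sums f z" and "cmod z < 1"
  shows "(f has_field_derivative deriv f z) (at z)"
    and "(\<lambda>n. of_nat (Suc n) * c (Suc n) * z ^ n) sums deriv f z"
proof -
  have "((\<lambda>z. \<Sum>n. c n * z ^ n) has_field_derivative (\<Sum>n. diffs c n * z ^ n)) (at z)"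
    using assms by (intro termdiffs_strong'[where K = 1]) (auto simp: sums_iff)
  moreover have "eventually (\<lambda>z. (\<Sum>n. c n * z ^ n) = f z) (nhds z)"
    using eventually_nhds_in_open[of "ball 0 1" z] assms
    by (auto elim!: eventually_mono simp: sums_iff)
  ultimately have "(f has_field_derivative (\<Sum>n. diffs c n * z ^ n)) (at z)"
    by (subst (asm) DERIV_cong_ev[OF refl _ refl]) auto
  then show *: "(f has_field_derivative deriv f z) (at z)"
    by (metis DERIV_imp_deriv)
  from termdiffs_sums_strong[OF assms(1) * assms(2)]
  show "(\<lambda>n. of_nat (Suc n) * c (Suc n) * z ^ n) sums deriv f z"
    by (simp add: diffs_def)
qed

lemma power_series_holomorphic:
  fixes c :: "nat \<Rightarrow> complex"
  assumes "\<And>z. cmod z < 1 \<Longrightarrow> (\<lambda>n. c n * z ^ n) sums f z"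
  shows "f holomorphic_on unit_disk"
  unfolding holomorphic_on_open[OF open_ball] using deriv_power_series(1)[of c f, OF assms] by (metis mem_ball_0)

text \<open>With \<open>u = deriv f\<close> this is the first-order operator
  \<open>u + \<mu> * z * u'\<close>. It acts diagonally on power series, and along a ray a lower
  bound on it can be pulled back to \<open>u\<close>.\<close>

abbreviation euler_op :: "real \<Rightarrow> (complex \<Rightarrow> complex) \<Rightarrow> complex \<Rightarrow> complex" where
  "euler_op \<mu> f z \<equiv> deriv f z + of_real \<mu> * z * deriv (deriv f) z"

lemma euler_op_sums:
  fixes c :: "nat \<Rightarrow> complex"
  assumes "\<And>z. cmod z < 1 \<Longrightarrow> (\<lambda>n. c n * z ^ n) sums f z" and "cmod z < 1"
  shows "(\<lambda>n. of_nat (Suc n) * (1 + of_real \<mu> * of_nat n) * c (Suc n) * z ^ n) sums euler_op \<mu> f z"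
proof -
  have d: "(\<lambda>n. of_nat (Suc n) * c (Suc n) * z ^ n) sums deriv f z" if "cmod z < 1" for z
    using deriv_power_series(2)[OF assms(1) that] by simp
  have "(\<lambda>n. of_nat (Suc n) * (of_nat (Suc (Suc n)) * c (Suc (Suc n))) * z ^ n)
      sums deriv (deriv f) z"
    by (rule deriv_power_series(2)[of "\<lambda>n. of_nat (Suc n) * c (Suc n)"]) (use d assms in auto)
  from sums_mult[OF this, of "of_real \<mu> * z"]
  have "(\<lambda>n. of_real \<mu> * of_nat (Suc n) * (of_nat (Suc (Suc n)) * c (Suc (Suc n))) * z ^ Suc n)
      sums (of_real \<mu> * z * deriv (deriv f) z)"
    by (simp add: mult_ac)
  \<comment> \<open>The factor \<open>of_nat n\<close> kills the term at 0, so the shifted series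
    may start there and be added to that of \<open>deriv f\<close>.\<close>
  then have "(\<lambda>n. of_real \<mu> * of_nat n * (of_nat (Suc n) * c (Suc n)) * z ^ n)
      sums (of_real \<mu> * z * deriv (deriv f) z)"
    by (subst (asm) sums_Suc_iff) simp
  from sums_add[OF d[OF assms(2)] this] show ?thesis
    by (simp add: algebra_simps)
qed

section \<open>Coefficient and growth inequalities for functions with positive real part\<close>

text \<open>Cauchy's formula for the \<open>k\<close>-th derivative, written as a Fourier
  coefficient: on the unit circle the inverse is the conjugate.\<close>

lemma cauchy_circle_mean:
  assumes hol: "f holomorphic_on unit_disk" and r: "0 < r" "r < 1"
  shows "((\<lambda>t. f (of_real r * exp (2 * of_real pi * \<i> * of_real t))
             * cnj (exp (2 * of_real pi * \<i> * of_real t)) ^ k)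
           has_integral ((deriv ^^ k) f 0 / fact k * of_real r ^ k)) {0..1}"
proof -
  have holb: "f holomorphic_on ball 0 r" and contb: "continuous_on (cball 0 r) f"
    using r by (auto intro!: holomorphic_on_subset[OF hol] holomorphic_on_imp_continuous_on)
  define C :: "real \<Rightarrow> complex" where "C t = exp (2 * of_real pi * \<i> * of_real t)" for t
  have C: "C t \<noteq> 0" "cnj (C t) = 1 / C t" for t
    by (simp_all add: C_def exp_cnj exp_minus inverse_eq_divide)
  have "((\<lambda>u. f u / (u - 0) ^ Suc k) has_contour_integral
           ((2 * pi * \<i>) / fact k * (deriv ^^ k) f 0)) (circlepath 0 r)"
    using r by (intro Cauchy_has_contour_integral_higher_derivative_circlepath contb holb) auto
  then have "((\<lambda>t. f (r * C t) / (r * C t) ^ Suc k * (2 * pi * \<i> * r * C t))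
      has_integral ((2 * pi * \<i>) / fact k * (deriv ^^ k) f 0)) {0..1}"
    unfolding has_contour_integral vector_derivative_circlepath
    by (simp add: circlepath C_def)
  from has_integral_mult_right[OF this, of "r ^ k / (2 * pi * \<i>)"] show ?thesis
    using r unfolding C_def[symmetric]
    by (simp add: C power_mult_distrib power_divide mult_ac)
qed

text \<open>The positive-frequency means of \<open>cnj p\<close> vanish, so \<open>p\<close> may be replaced by \<open>2 * Re p\<close> in the
  Cauchy integral for \<open>c n\<close>.\<close>

lemma caratheodory_coefficient:
  fixes c :: "nat \<Rightarrow> complex"
  assumes sums: "\<And>z. cmod z < 1 \<Longrightarrow> (\<lambda>n. c n * z ^ n) sums p z"
    and Re: "\<And>z. cmod z < 1 \<Longrightarrow> Re (p z) \<ge> 0" and "n > 0"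
  shows "cmod (c n) \<le> 2 * Re (c 0)"
proof -
  have hol: "p holomorphic_on unit_disk"
    by (rule power_series_holomorphic) fact
  have "eventually (\<lambda>u. (\<lambda>n. fps_nth (Abs_fps c) n * u ^ n) sums p u) (nhds 0)"
    using eventually_nhds_in_open[of "ball 0 1" "0::complex"] sums by (auto elim!: eventually_mono)
  then have "p has_fps_expansion Abs_fps c"
    by (rule has_fps_expansionI)
  then have der: "(deriv ^^ k) p 0 / fact k = c k" for k
    using fps_nth_fps_expansion[of p "Abs_fps c" k] by simp
  have *: "cmod (c n) * r ^ n \<le> 2 * Re (c 0)" if r: "0 < r" "r < 1" for r :: real
  proof -
    define C :: "real \<Rightarrow> complex" where "C t = exp (2 * of_real pi * \<i> * of_real t)" for t
    define q where "q t = p (r * C t)" for t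
    have C: "C t \<noteq> 0" "cmod (C t) = 1" for t
      by (auto simp: C_def)
    have int1: "((\<lambda>t. q t * cnj (C t) ^ k) has_integral (c k * r ^ k)) {0..1}" for k
      using cauchy_circle_mean[OF hol r, of k] unfolding der q_def C_def by simp
    \<comment> \<open>The case \<open>k = 0\<close> is the mean value property. This product
      vanishes at 0 because \<open>n > 0\<close>, and so does its mean.\<close>
    have "(\<lambda>z. p z * z ^ n) holomorphic_on unit_disk"
      by (intro holomorphic_intros hol)
    from has_integral_divide[OF cauchy_circle_mean[OF this r, of 0], of "r ^ n"]
    have int2: "((\<lambda>t. q t * C t ^ n) has_integral 0) {0..1}"
      using r \<open>n > 0\<close> by (simp add: q_def C_def power_mult_distrib zero_power)
    have "((\<lambda>t. cnj (q t) * cnj (C t) ^ n) has_integral 0) {0..1}"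
      using has_integral_cnj[of "\<lambda>t. q t * C t ^ n" 0 "{0..1}"] int2 by (simp add: o_def)
    from has_integral_add[OF int1[of n] this]
    have i: "((\<lambda>t. (q t + cnj (q t)) * cnj (C t) ^ n) has_integral (c n * r ^ n)) {0..1}"
      by (simp add: algebra_simps)
    have "((\<lambda>t. Re (q t)) has_integral Re (c 0)) {0..1}"
      using has_integral_linear[OF int1[of 0] bounded_linear_Re] by (simp add: o_def)
    from has_integral_mult_right[OF this, of 2]
    have j: "((\<lambda>t. 2 * Re (q t)) has_integral (2 * Re (c 0))) {0..1}" .
    have "cmod ((q t + cnj (q t)) * cnj (C t) ^ n) \<le> 2 * Re (q t)" for t
    proof -
      have "0 \<le> Re (q t)" unfolding q_def by (rule Re) (use r C in \<open>simp add: norm_mult\<close>)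
      then show ?thesis by (simp add: norm_mult norm_power C complex_add_cnj)
    qed
    then have "cmod (integral {0..1} (\<lambda>t. (q t + cnj (q t)) * cnj (C t) ^ n))
        \<le> integral {0..1} (\<lambda>t. 2 * Re (q t))"
      by (intro Henstock_Kurzweil_Integration.integral_norm_bound_integral
          has_integral_integrable[OF i] has_integral_integrable[OF j])
    then have "cmod (c n * r ^ n) \<le> 2 * Re (c 0)"
      unfolding integral_unique[OF i] integral_unique[OF j] .
    then show ?thesis using r by (simp add: norm_mult norm_power)
  qed
  have "((\<lambda>r. cmod (c n) * r ^ n) \<longlongrightarrow> cmod (c n) * 1 ^ n) (at_left (1::real))"
    by (intro tendsto_intros)
  moreover have "eventually (\<lambda>r. cmod (c n) * r ^ n \<le> 2 * Re (c 0)) (at_left (1::real))"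
    by (rule eventually_at_leftI[of 0]) (use * in auto)
  ultimately have "cmod (c n) * 1 ^ n \<le> 2 * Re (c 0)"
    by (rule tendsto_upperbound) simp
  then show ?thesis by simp
qed

text \<open>The Cayley transform \<open>w\<close> sends the right half-plane to the unit disk and
  fixes the origin here, so the Schwarz lemma gives \<open>cmod (w z) \<le> cmod z\<close>. Solving
  for \<open>Re (p z)\<close> yields the bound.\<close>

lemma harnack_lower_bound:
  assumes hol: "p holomorphic_on unit_disk"
    and Re: "\<And>z. cmod z < 1 \<Longrightarrow> Re (p z) > 0" and p0: "p 0 = 1" and z: "cmod z < 1"
  shows "(1 - cmod z) / (1 + cmod z) \<le> Re (p z)"
proof -
  define w where "w z = (p z - 1) / (p z + 1)" for z
  have nz: "p z + 1 \<noteq> 0" if "cmod z < 1" for z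
    using Re[OF that] by (auto simp: complex_eq_iff)
  have "w holomorphic_on unit_disk"
    unfolding w_def by (intro holomorphic_intros hol) (use nz in auto)
  moreover have "cmod (w z) < 1" if "cmod z < 1" for z
  proof -
    have "(cmod (p z - 1))\<^sup>2 < (cmod (p z + 1))\<^sup>2"
      unfolding cmod_power2 using Re[OF that] by (simp add: power2_eq_square algebra_simps)
    then have "cmod (p z - 1) < cmod (p z + 1)"
      by (rule power2_less_imp_less) simp
    then show ?thesis using nz[OF that] by (simp add: w_def norm_divide)
  qed
  moreover have "w 0 = 0" by (simp add: w_def p0)
  ultimately have "cmod (w z) \<le> cmod z"
    using z by (intro Schwarz_Lemma(1)) auto
  then have le: "cmod (p z - 1) \<le> cmod z * cmod (p z + 1)"
    using nz[OF z] by (simp add: w_def norm_divide divide_simps)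
  define x r where "x = Re (p z)" and "r = cmod z"
  have x: "x > 0" and r: "0 \<le> r" "r < 1" using Re z by (auto simp: x_def r_def)
  have "(cmod (p z - 1))\<^sup>2 \<le> (r * cmod (p z + 1))\<^sup>2"
    unfolding r_def by (intro power_mono le) auto
  then have "(x - 1)\<^sup>2 + (Im (p z))\<^sup>2 \<le> r\<^sup>2 * (x + 1)\<^sup>2 + r\<^sup>2 * (Im (p z))\<^sup>2"
    by (simp add: cmod_power2 power_mult_distrib x_def algebra_simps)
  moreover have "r\<^sup>2 * (Im (p z))\<^sup>2 \<le> 1 * (Im (p z))\<^sup>2"
    using r by (intro mult_right_mono) (auto simp: power_le_one)
  ultimately have "(1 - x)\<^sup>2 \<le> (r * (x + 1))\<^sup>2"
    by (simp add: power_mult_distrib power2_commute)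
  then have "1 - x \<le> r * (x + 1)"
    by (rule power2_le_imp_le) (use r x in auto)
  then show ?thesis using r unfolding x_def[symmetric] r_def[symmetric]
    by (simp add: divide_simps algebra_simps)
qed

text \<open>At a minimum of \<open>u\<close> on \<open>[0, r]\<close> either \<open>t = 0\<close> or \<open>u' t \<le> 0\<close>.\<close>

lemma euler_comparison:
  fixes u u' :: "real \<Rightarrow> real"
  assumes der: "\<And>t. 0 \<le> t \<Longrightarrow> t \<le> r \<Longrightarrow> (u has_real_derivative u' t) (at t)"
    and pos: "\<And>t. 0 \<le> t \<Longrightarrow> t \<le> r \<Longrightarrow> u t + \<mu> * t * u' t > 0"
    and "0 \<le> \<mu>" "0 \<le> r"
  shows "u r > 0"
proof (rule ccontr)
  assume "\<not> u r > 0"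
  have "continuous_on {0..r} u"
    by (intro DERIV_atLeastAtMost_imp_continuous_on) (use der in auto)
  then obtain s where s: "s \<in> {0..r}" "\<And>t. t \<in> {0..r} \<Longrightarrow> u s \<le> u t"
    using continuous_attains_inf[of "{0..r}" u] \<open>0 \<le> r\<close> by auto
  have us: "u s \<le> 0" using s(2)[of r] \<open>\<not> u r > 0\<close> \<open>0 \<le> r\<close> by simp
  have "s \<noteq> 0" using pos[of 0] us \<open>0 \<le> r\<close> by auto
  have "u' s \<le> 0"
  proof (rule ccontr)
    assume "\<not> u' s \<le> 0"
    then obtain d where d: "d > 0" "\<And>h. 0 < h \<Longrightarrow> h < d \<Longrightarrow> u (s - h) < u s"
      using DERIV_pos_inc_left[of u "u' s" s] der[of s] s by auto
    define h where "h = min (d / 2) s"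
    have "0 < h" "h < d" "s - h \<in> {0..r}"
      using d s \<open>s \<noteq> 0\<close> by (auto simp: h_def)
    then show False using d(2)[of h] s(2)[of "s - h"] by auto
  qed
  then have "\<mu> * s * u' s \<le> 0"
    using s \<open>0 \<le> \<mu>\<close> by (auto simp: mult_nonneg_nonpos)
  then show False using pos[of s] s us by auto
qed

text \<open>The weight \<open>w\<close> serves two uses: \<open>w = 1\<close> for derivatives along
  a ray, and \<open>w = cnj \<zeta>\<close> to rotate the values of a function back to the real
  direction.\<close>

lemma radial_derivative:
  assumes "(f has_field_derivative D) (at (of_real t * \<zeta>))"
  shows "((\<lambda>t. Re (w * f (of_real t * \<zeta>))) has_real_derivative Re (w * (D * \<zeta>))) (at t)"
proof -
  have "((\<lambda>x. x * \<zeta>) has_field_derivative \<zeta>) (at (of_real t))"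
    by (auto intro!: derivative_eq_intros)
  from DERIV_cmult[OF DERIV_chain2[OF assms this], of w]
  have "((\<lambda>t. w * f (of_real t * \<zeta>)) has_vector_derivative w * (D * \<zeta>)) (at t)"
    by (rule has_vector_derivative_real_field)
  then show ?thesis
    by (rule has_field_derivative_Re)
qed

text \<open>The origin is given the direction 1, which spares later case distinctions.\<close>

lemma complex_polar_direction:
  obtains \<zeta> where "cmod \<zeta> = 1" "z = of_real (cmod z) * \<zeta>"
proof (cases "z = 0")
  case True
  then show ?thesis using that[of 1] by simp
next
  case False
  then show ?thesis
    using that[of "z / of_real (cmod z)"] by (simp add: norm_divide)
qed

text \<open>Multiplying by the conjugate of the denominator leaves the real part
  \<open>1 - (cmod z)\<^sup>2\<close>.\<close>

lemma Re_moebius_pos: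
  assumes "cmod z < 1"
  shows "Re ((1 + z) / (1 - z)) > 0"
proof -
  have "z \<noteq> 1" using assms by auto
  have "(cmod z)\<^sup>2 < 1" using assms by (simp add: power_less_one_iff abs_square_less_1)
  then have "Re ((1 + z) * cnj (1 - z)) > 0"
    unfolding cmod_power2 by (simp add: power2_eq_square algebra_simps)
  then show ?thesis
    using \<open>z \<noteq> 1\<close> by (simp add: complex_div_cnj[of _ "1 - z"] del: complex_cnj_diff)
qed

section \<open>The extremal function and the analytic class\<close>

locale bohr_parameters =
  fixes \<mu> \<rho> :: real
  assumes mu: "0 \<le> \<mu>" and rho: "0 \<le> \<rho>" "\<rho> < 1"
begin

text \<open>For \<open>n \<ge> 2\<close> this is the sharp bound on the coefficients. The value at 1
  is not the coefficient of the extremal function, which \<open>ext_coeff\<close> sets to 1.\<close>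

definition kappa :: "nat \<Rightarrow> real" where
  "kappa n = 2 * (1 - \<rho>) / (real n * (1 + \<mu> * (real n - 1)))"

definition ext_coeff :: "nat \<Rightarrow> real" where
  "ext_coeff n = (if n = 0 then 0 else if n = 1 then 1 else kappa n)"

text \<open>The solution of
  \<open>F' + \<mu> z F'' = \<rho> + (1 - \<rho>) (1 + z) / (1 - z)\<close> on the disk with
  \<open>F 0 = 0\<close>.\<close>

definition extremal :: "complex \<Rightarrow> complex" where
  "extremal z = (\<Sum>n. of_real (ext_coeff n) * z ^ n)"

lemma kappa_pos: "n \<ge> 1 \<Longrightarrow> kappa n > 0"
  using mu rho by (auto simp: kappa_def intro!: divide_pos_pos mult_pos_pos add_pos_nonneg)

lemma kappa_le: "n \<ge> 1 \<Longrightarrow> kappa n \<le> 2 / real n"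
proof -
  assume n: "n \<ge> 1"
  have "real n * 1 \<le> real n * (1 + \<mu> * (real n - 1))"
    using n mu by (intro mult_left_mono) auto
  then show "kappa n \<le> 2 / real n"
    unfolding kappa_def using n rho by (intro frac_le) auto
qed

text \<open>Monotonicity feeds the Leibniz criterion up to radius 1; strictness later gives
  \<open>growth 1 < 1\<close>.\<close>

lemma kappa_decreasing: "1 \<le> m \<Longrightarrow> m < n \<Longrightarrow> kappa n < kappa m"
proof -
  assume mn: "1 \<le> m" "m < n"
  have "\<mu> * (real m - 1) \<le> \<mu> * (real n - 1)"
    using mn mu by (intro mult_left_mono) auto
  moreover have "0 \<le> \<mu> * (real m - 1)"
    using mn mu by auto
  ultimately have "real m * (1 + \<mu> * (real m - 1)) < real n * (1 + \<mu> * (real n - 1))"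
    using mn by (intro mult_less_le_imp_less) auto
  then show "kappa n < kappa m"
    unfolding kappa_def using mn rho mu
    by (intro divide_strict_left_mono mult_pos_pos add_pos_nonneg mult_nonneg_nonneg) auto
qed

lemma kappa_tendsto: "kappa \<longlonglongrightarrow> 0"
proof (rule tendsto_sandwich)
  show "eventually (\<lambda>n. 0 \<le> kappa n) sequentially"
    using kappa_pos by (auto intro!: eventually_sequentiallyI[of 1] less_imp_le)
  show "eventually (\<lambda>n. kappa n \<le> 2 / real n) sequentially"
    using kappa_le by (auto intro!: eventually_sequentiallyI[of 1])
  show "(\<lambda>n. 2 / real n) \<longlonglongrightarrow> 0"
    by (rule lim_const_over_n)
qed simp

lemma ext_coeff_bounds: "0 \<le> ext_coeff n" "ext_coeff n \<le> 1"
proof -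
  show "0 \<le> ext_coeff n"
    using kappa_pos[of n] by (auto simp: ext_coeff_def)
  have "kappa n \<le> 1" if "n \<ge> 2"
  proof -
    have "2 / real n \<le> 1" using that by simp
    then show ?thesis using kappa_le[of n] that by linarith
  qed
  then show "ext_coeff n \<le> 1" by (auto simp: ext_coeff_def)
qed

lemma ext_coeff_summable:
  assumes "\<bar>r\<bar> < 1"
  shows "summable (\<lambda>n. ext_coeff n * r ^ n)"
proof (rule summable_comparison_test')
  show "summable (\<lambda>n. \<bar>r\<bar> ^ n)" using assms by (simp add: summable_geometric)
  show "norm (ext_coeff n * r ^ n) \<le> \<bar>r\<bar> ^ n" for n
    using ext_coeff_bounds[of n] by (simp add: abs_mult power_abs mult_left_le_one_le)
qed

lemma extremal_sums:
  assumes "cmod z < 1"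
  shows "(\<lambda>n. of_real (ext_coeff n) * z ^ n) sums extremal z"
proof -
  have "summable (\<lambda>n. complex_of_real (ext_coeff n) * z ^ n)"
  proof (rule summable_comparison_test')
    show "summable (\<lambda>n. cmod z ^ n)" using assms by (simp add: summable_geometric)
    show "norm (of_real (ext_coeff n) * z ^ n) \<le> cmod z ^ n" for n
      using ext_coeff_bounds[of n] by (simp add: norm_mult norm_power mult_left_le_one_le)
  qed
  then show ?thesis by (simp add: extremal_def summable_sums)
qed

lemma euler_op_coeff_extremal:
  "real (Suc n) * (1 + \<mu> * real n) * ext_coeff (Suc n) = (if n = 0 then 1 else 2 * (1 - \<rho>))"
proof (cases "n = 0")
  case False
  have "1 + \<mu> * real n > 0" using mu by (intro add_pos_nonneg) auto
  then show ?thesis using False by (simp add: ext_coeff_def kappa_def)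
qed (simp add: ext_coeff_def)

lemma euler_op_extremal:
  assumes z: "cmod z < 1"
  shows "euler_op \<mu> extremal z = of_real \<rho> + of_real (1 - \<rho>) * ((1 + z) / (1 - z))"
proof -
  have "z \<noteq> 1" using z by auto
  have "(\<lambda>n. complex_of_real (real (Suc n) * (1 + \<mu> * real n) * ext_coeff (Suc n)) * z ^ n)
      sums euler_op \<mu> extremal z"
    using euler_op_sums[OF extremal_sums z, of \<mu>] by (simp add: mult_ac)
  then have 1: "(\<lambda>n. of_real (if n = 0 then 1 else 2 * (1 - \<rho>)) * z ^ n) sums euler_op \<mu> extremal z"
    unfolding euler_op_coeff_extremal .
  \<comment> \<open>A geometric series corrected at index 0, where
    \<open>2 * (1 - \<rho>) - (1 - 2 * \<rho>) = 1\<close>.\<close>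
  have "(\<lambda>n. of_real (2 * (1 - \<rho>)) * z ^ n - (if n = 0 then of_real (1 - 2 * \<rho>) else 0))
      sums (of_real (2 * (1 - \<rho>)) * (1 / (1 - z)) - of_real (1 - 2 * \<rho>))"
    using z by (intro sums_diff sums_mult geometric_sums
        sums_single[of 0 "\<lambda>_. complex_of_real (1 - 2 * \<rho>)"])
  also have "(\<lambda>n. of_real (2 * (1 - \<rho>)) * z ^ n - (if n = 0 then of_real (1 - 2 * \<rho>) else 0))
      = (\<lambda>n. of_real (if n = 0 then 1 else 2 * (1 - \<rho>)) * z ^ n)"
    by (auto simp: fun_eq_iff)
  finally have "euler_op \<mu> extremal z = of_real (2 * (1 - \<rho>)) * (1 / (1 - z)) - of_real (1 - 2 * \<rho>)"
    using 1 sums_unique2 by blast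
  also have "\<dots> = of_real \<rho> + of_real (1 - \<rho>) * ((1 + z) / (1 - z))"
    using \<open>z \<noteq> 1\<close> by (simp add: divide_simps) (simp add: algebra_simps)
  finally show ?thesis .
qed

text \<open>On the negative radius the Moebius factor equals Harnack's lower bound, which is why the
  extremal function is compared there.\<close>

lemma Re_euler_op_extremal_neg:
  assumes "0 \<le> r" "r < 1"
  shows "Re (euler_op \<mu> extremal (- of_real r)) = \<rho> + (1 - \<rho>) * ((1 - r) / (1 + r))"
proof -
  have "euler_op \<mu> extremal (- of_real r) = of_real (\<rho> + (1 - \<rho>) * ((1 - r) / (1 + r)))"
    using assms by (subst euler_op_extremal) auto
  then show ?thesis by (simp only: Re_complex_of_real)
qed

section \<open>The analytic class and its comparison with the extremal function\<close>

text \<open>The analytic counterpart of the harmonic class, into which every rotation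
  \<open>h + \<epsilon> * g\<close> falls. The coefficients are carried along for Caratheodory's
  inequality.\<close>

definition in_class :: "(complex \<Rightarrow> complex) \<Rightarrow> (nat \<Rightarrow> complex) \<Rightarrow> bool" where
  "in_class F c \<longleftrightarrow> c 0 = 0 \<and> c 1 = 1 \<and>
     (\<forall>z. cmod z < 1 \<longrightarrow> (\<lambda>n. c n * z ^ n) sums F z \<and> \<rho> < Re (euler_op \<mu> F z))"

lemma in_classD:
  assumes "in_class F c"
  shows "c 0 = 0" "c 1 = 1" "cmod z < 1 \<Longrightarrow> (\<lambda>n. c n * z ^ n) sums F z"
    "cmod z < 1 \<Longrightarrow> \<rho> < Re (euler_op \<mu> F z)"
  using assms by (auto simp: in_class_def)

lemma in_class_extremal: "in_class extremal (\<lambda>n. of_real (ext_coeff n))"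
proof -
  have "\<rho> < Re (euler_op \<mu> extremal z)" if "cmod z < 1" for z
  proof -
    have *: "Re (of_real \<rho> + of_real (1 - \<rho>) * w) = \<rho> + (1 - \<rho>) * Re w" for w
      by simp
    then show ?thesis
      unfolding euler_op_extremal[OF that] *
      using mult_pos_pos[OF _ Re_moebius_pos[OF that], of "1 - \<rho>"] rho by linarith
  qed
  then show ?thesis
    using extremal_sums by (auto simp: in_class_def ext_coeff_def)
qed

text \<open>Subtracting \<open>\<rho>\<close> changes only the constant term, to
  \<open>1 - \<rho>\<close>, and leaves a function with positive real part.\<close>

lemma in_class_euler_sums:
  assumes F: "in_class F c" and z: "cmod z < 1"
  shows "(\<lambda>n. (of_nat (Suc n) * (1 + of_real \<mu> * of_nat n) * c (Suc n)
                - (if n = 0 then of_real \<rho> else 0)) * z ^ n)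
           sums (euler_op \<mu> F z - of_real \<rho>)"
proof -
  have "(\<lambda>n. of_nat (Suc n) * (1 + of_real \<mu> * of_nat n) * c (Suc n) * z ^ n
            - (if n = 0 then of_real \<rho> else 0)) sums (euler_op \<mu> F z - of_real \<rho>)"
    by (intro sums_diff euler_op_sums z in_classD(3)[OF F]
        sums_single[of 0 "\<lambda>_. of_real \<rho>", simplified])
  also have "(\<lambda>n. of_nat (Suc n) * (1 + of_real \<mu> * of_nat n) * c (Suc n) * z ^ n
            - (if n = 0 then of_real \<rho> else 0)) =
      (\<lambda>n. (of_nat (Suc n) * (1 + of_real \<mu> * of_nat n) * c (Suc n)
                - (if n = 0 then of_real \<rho> else 0)) * z ^ n)"
    by (auto simp: fun_eq_iff)
  finally show ?thesis .
qed

lemma in_class_coeff_bound: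
  assumes F: "in_class F c" and n: "n \<ge> 2"
  shows "cmod (c n) \<le> kappa n"
proof -
  obtain k where k: "n = Suc k" "k > 0" using n by (cases n) auto
  have pos: "1 + \<mu> * real k > 0" using mu by (intro add_pos_nonneg) auto
  have "cmod (of_nat (Suc k) * (1 + of_real \<mu> * of_nat k) * c (Suc k)
                - (if k = 0 then of_real \<rho> else 0))
      \<le> 2 * Re (of_nat (Suc 0) * (1 + of_real \<mu> * of_nat 0) * c (Suc 0)
                - (if 0 = (0::nat) then of_real \<rho> else 0))"
    by (rule caratheodory_coefficient[OF in_class_euler_sums[OF F]])
       (use in_classD(4)[OF F] k in \<open>auto intro: less_imp_le\<close>)
  moreover have "of_nat (Suc k) * (1 + of_real \<mu> * of_nat k) * c (Suc k)
      = of_real (real n * (1 + \<mu> * real k)) * c n"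
    by (simp add: k)
  ultimately have "cmod (of_real (real n * (1 + \<mu> * real k)) * c n) \<le> 2 * (1 - \<rho>)"
    using in_classD(2)[OF F] k by simp
  then have "real n * (1 + \<mu> * real k) * cmod (c n) \<le> 2 * (1 - \<rho>)"
    using pos by (simp only: norm_mult norm_of_real) (simp add: abs_mult)
  then show ?thesis
    using pos n k by (simp add: kappa_def pos_le_divide_eq mult_ac)
qed

text \<open>Normalising to \<open>p 0 = 1\<close> makes Harnack's inequality applicable; its lower
  bound is the value of the extremal function on the negative radius.\<close>

lemma in_class_euler_op_ge:
  assumes F: "in_class F c" and z: "cmod z < 1"
  shows "Re (euler_op \<mu> extremal (- of_real (cmod z))) \<le> Re (euler_op \<mu> F z)"
proof -
  define p where "p z = (euler_op \<mu> F z - of_real \<rho>) / of_real (1 - \<rho>)" for z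
  have "(\<lambda>z. euler_op \<mu> F z - of_real \<rho>) holomorphic_on unit_disk"
    by (rule power_series_holomorphic[OF in_class_euler_sums[OF F]])
  then have "p holomorphic_on unit_disk"
    unfolding p_def using rho by (intro holomorphic_on_divide holomorphic_on_const) auto
  moreover have Re_p: "Re (p z) = (Re (euler_op \<mu> F z) - \<rho>) / (1 - \<rho>)" for z
    unfolding p_def by (subst Re_divide_of_real) simp
  have "Re (p z) > 0" if "cmod z < 1" for z
    unfolding Re_p using in_classD(4)[OF F that] rho by simp
  moreover have "p 0 = 1"
  proof -
    have "deriv F 0 = 1"
      using deriv_power_series(2)[OF in_classD(3)[OF F], of 0] in_classD(2)[OF F] by simp
    then show ?thesis using rho by (simp add: p_def)
  qed
  ultimately have "(1 - cmod z) / (1 + cmod z) \<le> (Re (euler_op \<mu> F z) - \<rho>) / (1 - \<rho>)"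
    unfolding Re_p[symmetric] using z by (intro harnack_lower_bound) auto
  then have "(1 - \<rho>) * ((1 - cmod z) / (1 + cmod z)) \<le> Re (euler_op \<mu> F z) - \<rho>"
    using rho by (simp add: pos_le_divide_eq mult_ac)
  then show ?thesis
    using z by (subst Re_euler_op_extremal_neg) auto
qed

lemma in_class_derivatives:
  assumes F: "in_class F c" and z: "cmod z < 1"
  shows "(F has_field_derivative deriv F z) (at z)"
    and "(deriv F has_field_derivative deriv (deriv F) z) (at z)"
proof -
  have "F holomorphic_on unit_disk"
    by (rule power_series_holomorphic[OF in_classD(3)[OF F]])
  then show "(F has_field_derivative deriv F z) (at z)"
    "(deriv F has_field_derivative deriv (deriv F) z) (at z)"
    using z by (auto intro!: holomorphic_derivI[of _ unit_disk] holomorphic_deriv)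
qed

text \<open>For \<open>u t = Re (deriv F (t * \<zeta>))\<close> the expression
  \<open>u + \<mu> * t * u'\<close> is the real part of \<open>euler_op \<mu> F\<close> on the ray,
  which exceeds \<open>\<rho> \<ge> 0\<close>.\<close>

lemma in_class_deriv_pos:
  assumes F: "in_class F c" and z: "cmod z < 1"
  shows "Re (deriv F z) > 0"
proof -
  obtain \<zeta> where \<zeta>: "cmod \<zeta> = 1" "z = of_real (cmod z) * \<zeta>"
    by (rule complex_polar_direction)
  have small: "cmod (of_real t * \<zeta>) < 1" if "0 \<le> t" "t \<le> cmod z" for t
    using that z \<zeta> by (simp add: norm_mult)
  have "Re (1 * deriv F (of_real (cmod z) * \<zeta>)) > 0"
  proof (rule euler_comparison[where r = "cmod z" and
      u = "\<lambda>t. Re (1 * deriv F (of_real t * \<zeta>))"])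
    fix t assume t: "0 \<le> t" "t \<le> cmod z"
    show "((\<lambda>t. Re (1 * deriv F (of_real t * \<zeta>))) has_real_derivative
        Re (1 * (deriv (deriv F) (of_real t * \<zeta>) * \<zeta>))) (at t)"
      by (rule radial_derivative in_class_derivatives(2)[OF F] small t)+
    show "0 < Re (1 * deriv F (of_real t * \<zeta>)) +
        \<mu> * t * Re (1 * (deriv (deriv F) (of_real t * \<zeta>) * \<zeta>))"
      using in_classD(4)[OF F small[OF t]] rho by (simp add: algebra_simps)
  qed (use mu in auto)
  then show ?thesis using \<zeta> by simp
qed

lemma in_class_deriv_ge:
  assumes F: "in_class F c" and \<zeta>: "cmod \<zeta> = 1" and r: "0 \<le> r" "r < 1"
  shows "Re (deriv extremal (- of_real r)) \<le> Re (deriv F (of_real r * \<zeta>))"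
\<comment> \<open>The comparison of the Euler operators is not strict, whereas
  \<open>euler_comparison\<close> needs strict positivity; adding \<open>\<delta>\<close> provides
  it.\<close>
proof (rule field_le_epsilon)
  fix \<delta> :: real assume "\<delta> > 0"
  have small: "cmod (of_real t * \<zeta>) < 1" "cmod (of_real t * (-1)) < 1" if "0 \<le> t" "t \<le> r" for t
    using that r \<zeta> by (auto simp: norm_mult)
  have "Re (1 * deriv F (of_real r * \<zeta>)) - Re (1 * deriv extremal (of_real r * (-1))) + \<delta> > 0"
  proof (rule euler_comparison[where r = r and
      u = "\<lambda>t. Re (1 * deriv F (of_real t * \<zeta>)) - Re (1 * deriv extremal (of_real t * (-1))) + \<delta>"])
    fix t assume t: "0 \<le> t" "t \<le> r"
    show "((\<lambda>t. Re (1 * deriv F (of_real t * \<zeta>)) - Re (1 * deriv extremal (of_real t * (-1))) + \<delta>)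
        has_real_derivative
        Re (1 * (deriv (deriv F) (of_real t * \<zeta>) * \<zeta>))
          - Re (1 * (deriv (deriv extremal) (of_real t * (-1)) * (-1))) + 0) (at t)"
      by (rule DERIV_add DERIV_diff DERIV_const radial_derivative in_class_derivatives(2)[OF F]
          in_class_derivatives(2)[OF in_class_extremal] small t)+
    have "Re (euler_op \<mu> extremal (- of_real t)) \<le> Re (euler_op \<mu> F (of_real t * \<zeta>))"
      using in_class_euler_op_ge[OF F small(1)[OF t]] \<zeta> t by (simp add: norm_mult)
    then show "0 < Re (1 * deriv F (of_real t * \<zeta>)) - Re (1 * deriv extremal (of_real t * (-1))) + \<delta>
        + \<mu> * t * (Re (1 * (deriv (deriv F) (of_real t * \<zeta>) * \<zeta>))
          - Re (1 * (deriv (deriv extremal) (of_real t * (-1)) * (-1))) + 0)"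
      using \<open>\<delta> > 0\<close> by (simp add: algebra_simps)
  qed (use mu r in auto)
  then show "Re (deriv extremal (- of_real r)) \<le> Re (deriv F (of_real r * \<zeta>)) + \<delta>"
    by simp
qed

text \<open>The comparison of derivatives is integrated along the ray, both functions being 0 at the
  origin.\<close>

lemma in_class_growth:
  assumes F: "in_class F c" and \<zeta>: "cmod \<zeta> = 1" and r: "0 \<le> r" "r < 1"
  shows "- Re (extremal (- of_real r)) \<le> Re (cnj \<zeta> * F (of_real r * \<zeta>))"
proof -
  define v where "v t = Re (cnj \<zeta> * F (of_real t * \<zeta>)) - Re ((-1) * extremal (of_real t * (-1)))" for t
  have small: "cmod (of_real t * \<zeta>) < 1" "cmod (of_real t * (-1)) < 1" if "0 \<le> t" "t \<le> r" for t
    using that r \<zeta> by (auto simp: norm_mult)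
  have "v 0 \<le> v r"
  proof (rule DERIV_nonneg_imp_nondecreasing[OF r(1)])
    fix t assume t: "0 \<le> t" "t \<le> r"
    have "(v has_real_derivative
        Re (cnj \<zeta> * (deriv F (of_real t * \<zeta>) * \<zeta>)) - Re ((-1) * (deriv extremal (of_real t * (-1)) * (-1)))) (at t)"
      unfolding v_def
      by (rule DERIV_diff radial_derivative in_class_derivatives(1)[OF F]
          in_class_derivatives(1)[OF in_class_extremal] small t)+
    moreover have "cnj \<zeta> * (w * \<zeta>) = w" for w
      using \<zeta> complex_norm_square[of \<zeta>] by (simp add: mult_ac)
    ultimately show "\<exists>y. (v has_real_derivative y) (at t) \<and> 0 \<le> y"
      using in_class_deriv_ge[OF F \<zeta>, of t] t r by fastforce
  qed
  moreover have "F 0 = 0" "extremal 0 = 0"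
    using in_classD(3)[OF F, of 0] in_classD(1)[OF F] extremal_sums[of 0]
    by (auto simp: ext_coeff_def)
  ultimately show ?thesis by (simp add: v_def)
qed

section \<open>The radial minimum function up to the endpoint 1\<close>

text \<open>On \<open>[0, 1)\<close> this is \<open>- extremal (- r)\<close>; the series also converges at \<open>r = 1\<close>, by Leibniz.\<close>

definition growth :: "real \<Rightarrow> real" where
  "growth r = r - (\<Sum>n. (-1) ^ n * (kappa (n + 2) * r ^ (n + 2)))"

lemma growth_alternating:
  assumes "0 \<le> r" "r \<le> 1"
  shows "(\<lambda>n. kappa (n + 2) * r ^ (n + 2)) \<longlonglongrightarrow> 0"
    and "0 \<le> kappa (n + 2) * r ^ (n + 2)"
    and "kappa (Suc n + 2) * r ^ (Suc n + 2) \<le> kappa (n + 2) * r ^ (n + 2)"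
proof -
  show nn: "0 \<le> kappa (n + 2) * r ^ (n + 2)" for n
    using assms kappa_pos[of "n + 2"] by simp
  show "(\<lambda>n. kappa (n + 2) * r ^ (n + 2)) \<longlonglongrightarrow> 0"
  proof (rule tendsto_sandwich[OF _ _ tendsto_const LIMSEQ_ignore_initial_segment[OF kappa_tendsto, of 2]])
    show "eventually (\<lambda>n. kappa (n + 2) * r ^ (n + 2) \<le> kappa (n + 2)) sequentially"
      using assms by (intro always_eventually allI mult_right_le_one_le power_le_one zero_le_power
          less_imp_le[OF kappa_pos]) auto
  qed (use nn in auto)
  show "kappa (Suc n + 2) * r ^ (Suc n + 2) \<le> kappa (n + 2) * r ^ (n + 2)"
    using assms kappa_pos[of "n+2"] kappa_decreasing[of "n+2" "Suc n + 2"] kappa_pos[of "Suc n+2"]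
    by (intro mult_mono power_decreasing) auto
qed

text \<open>Even and odd Leibniz partial sums enclose the series. This covers \<open>r = 1\<close>,
  where convergence is only conditional if \<open>\<mu> = 0\<close>.\<close>

lemma growth_bounds:
  assumes "0 \<le> r" "r \<le> 1"
  shows "r - growth r \<le> (\<Sum>i<2*n+1. (-1) ^ i * (kappa (i + 2) * r ^ (i + 2)))"
    and "(\<Sum>i<2*n. (-1) ^ i * (kappa (i + 2) * r ^ (i + 2))) \<le> r - growth r"
    and "summable (\<lambda>n. (-1) ^ n * (kappa (n + 2) * r ^ (n + 2)))"
proof -
  note a = growth_alternating[OF assms]
  show "r - growth r \<le> (\<Sum>i<2*n+1. (-1) ^ i * (kappa (i + 2) * r ^ (i + 2)))"
    using summable_Leibniz'(4)[OF a] by (simp add: growth_def)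
  show "(\<Sum>i<2*n. (-1) ^ i * (kappa (i + 2) * r ^ (i + 2))) \<le> r - growth r"
    using summable_Leibniz'(2)[OF a] by (simp add: growth_def)
  show "summable (\<lambda>n. (-1) ^ n * (kappa (n + 2) * r ^ (n + 2)))"
    using summable_Leibniz'(1)[OF a] .
qed

text \<open>An instance of Abel's theorem: consecutive partial sums enclose the limit, so the error
  is at most \<open>kappa (2 * n + 2)\<close>, uniformly in \<open>r\<close>.\<close>

lemma growth_continuous: "continuous_on {0..1} growth"
proof -
  define S where "S n r = (\<Sum>i<2*n. (-1) ^ i * (kappa (i + 2) * r ^ (i + 2)))" for n and r :: real
  have "uniform_limit {0..1} S (\<lambda>r. r - growth r) sequentially"
  proof (rule uniform_limitI)
    fix e :: real assume "e > 0"
    have "strict_mono (\<lambda>n::nat. 2 * n + 2)" by (auto simp: strict_mono_def)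
    from LIMSEQ_subseq_LIMSEQ[OF kappa_tendsto this]
    have "(\<lambda>n. kappa (2 * n + 2)) \<longlonglongrightarrow> 0" by (simp add: o_def)
    then have "eventually (\<lambda>n. kappa (2 * n + 2) < e) sequentially"
      using \<open>e > 0\<close> by (rule order_tendstoD)
    then show "eventually (\<lambda>n. \<forall>r\<in>{0..1}. dist (S n r) (r - growth r) < e) sequentially"
    proof eventually_elim
      case (elim n)
      show ?case
      proof
        fix r :: real assume r: "r \<in> {0..1}"
        then have "0 \<le> r" "r \<le> 1" by auto
        note b = growth_bounds(1,2)[OF this, of n]
        have "kappa (2 * n + 2) * r ^ (2 * n + 2) \<le> kappa (2 * n + 2)"
          using r by (intro mult_right_le_one_le power_le_one zero_le_power
              less_imp_le[OF kappa_pos]) auto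
        then show "dist (S n r) (r - growth r) < e"
          using b elim by (simp add: S_def dist_real_def)
      qed
    qed
  qed
  then have "continuous_on {0..1} (\<lambda>r. r - growth r)"
    by (rule uniform_limit_theorem[rotated])
       (auto intro!: always_eventually continuous_intros simp: S_def)
  from continuous_on_diff[OF continuous_on_id this] show ?thesis by simp
qed

lemma growth_eq_extremal:
  assumes "0 \<le> r" "r < 1"
  shows "extremal (- of_real r) = of_real (- growth r)"
proof -
  have "(\<lambda>n. of_real (ext_coeff n) * (- complex_of_real r) ^ n) sums extremal (- of_real r)"
    using assms by (intro extremal_sums) auto
  then have "(\<lambda>n. of_real (ext_coeff (n + 2)) * (- complex_of_real r) ^ (n + 2))
      sums (extremal (- of_real r) - (\<Sum>i<2. of_real (ext_coeff i) * (- complex_of_real r) ^ i))"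
    by (rule sums_split_initial_segment)
  then have "(\<lambda>n. complex_of_real ((-1) ^ n * (kappa (n + 2) * r ^ (n + 2))))
      sums (extremal (- of_real r) + of_real r)"
    by (simp add: ext_coeff_def numeral_2_eq_2 power_minus[of "complex_of_real r"] mult_ac)
  moreover have "(\<lambda>n. complex_of_real ((-1) ^ n * (kappa (n + 2) * r ^ (n + 2))))
      sums of_real (r - growth r)"
    using growth_bounds(3)[of r] assms
    by (intro sums_of_real) (auto simp: growth_def summable_sums)
  ultimately have "extremal (- of_real r) + of_real r = of_real (r - growth r)"
    by (rule sums_unique2)
  then show ?thesis by (simp add: algebra_simps eq_neg_iff_add_eq_0)
qed

text \<open>The derivative of \<open>- extremal (- t)\<close> is
  \<open>deriv extremal (- t)\<close>, whose real part is positive.\<close>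

lemma growth_strict_mono:
  assumes "0 \<le> r" "r < s" "s < 1"
  shows "growth r < growth s"
proof -
  define v where "v t = Re ((-1) * extremal (of_real t * (-1)))" for t
  have v: "v t = growth t" if "0 \<le> t" "t < 1" for t
    using growth_eq_extremal[OF that] by (simp add: v_def)
  have "v r < v s"
  proof (rule DERIV_pos_imp_increasing[OF assms(2)])
    fix t assume t: "r \<le> t" "t \<le> s"
    then have small: "cmod (of_real t * (-1)) < 1" using assms by simp
    have "(v has_real_derivative Re ((-1) * (deriv extremal (of_real t * (-1)) * (-1)))) (at t)"
      unfolding v_def
      by (rule radial_derivative in_class_derivatives(1)[OF in_class_extremal] small)+
    moreover have "Re ((-1) * (deriv extremal (of_real t * (-1)) * (-1))) > 0"
      using in_class_deriv_pos[OF in_class_extremal small] by simp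
    ultimately show "\<exists>y. (v has_real_derivative y) (at t) \<and> 0 < y" by blast
  qed
  then show ?thesis using v assms by simp
qed

lemma growth_0: "growth 0 = 0"
  by (simp add: growth_def)

lemma growth_pos: "0 < r \<Longrightarrow> r < 1 \<Longrightarrow> 0 < growth r"
  using growth_strict_mono[of 0 r] growth_0 by simp

lemma growth_tendsto: "(growth \<longlongrightarrow> growth 1) (at_left 1)"
proof -
  have "(growth \<longlongrightarrow> growth 1) (at 1 within {0..1})"
    using growth_continuous by (auto simp: continuous_on_def)
  then show ?thesis
    by (simp add: at_within_Icc_at_left)
qed

lemma growth_1_bounds: "0 < growth 1" "growth 1 < 1"
proof -
  have "eventually (\<lambda>r. growth (1/2) \<le> growth r) (at_left 1)"
    by (rule eventually_at_leftI[of "1/2"]) (use growth_strict_mono[of "1/2"] in \<open>auto simp: less_imp_le\<close>)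
  then have "growth (1/2) \<le> growth 1"
    by (rule tendsto_lowerbound[OF growth_tendsto]) simp
  then show "0 < growth 1" using growth_pos[of "1/2"] by simp
  \<comment> \<open>The first two terms of the series already give
    \<open>1 - growth 1 \<ge> kappa 2 - kappa 3 > 0\<close>.\<close>
  have "kappa 3 < kappa 2" by (rule kappa_decreasing) auto
  then show "growth 1 < 1"
    using growth_bounds(2)[of 1 1] by (simp add: numeral_2_eq_2 eval_nat_numeral)
qed

end

section \<open>Uniqueness of the decomposition and boundary behaviour of embeddings\<close>

text \<open>Otherwise the image would be open and contain a non-real point above a real one.\<close>

lemma real_valued_holomorphic_constant:
  assumes hol: "f holomorphic_on S" and S: "open S" "connected S"
    and real: "\<And>z. z \<in> S \<Longrightarrow> Im (f z) = 0"
  shows "f constant_on S"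
proof (cases "S = {}")
  case False
  then obtain z where z: "z \<in> S" by auto
  show ?thesis
  proof (rule ccontr)
    assume "\<not> f constant_on S"
    then have "open (f ` S)"
      using open_mapping_thm[OF hol S(1,2) S(1)] by simp
    then obtain e where e: "e > 0" "ball (f z) e \<subseteq> f ` S"
      using z by (auto simp: open_contains_ball)
    have "f z + of_real (e / 2) * \<i> \<in> ball (f z) e"
      using e by (simp add: dist_norm norm_mult)
    then obtain w where "w \<in> S" "f w = f z + of_real (e / 2) * \<i>"
      using e by auto
    then show False using real[of w] real[of z] z e by simp
  qed
qed (simp add: constant_on_def)

text \<open>The difference \<open>h - h' = cnj (g' - g)\<close> is both holomorphic and antiholomorphic.\<close>

lemma H0_decomposition_unique:
  assumes 1: "H0_decomposition f h g a b" and 2: "H0_decomposition f h' g' a' b'"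
    and z: "z \<in> unit_disk"
  shows "h z = h' z" "g z = g' z"
proof -
  have zero: "h 0 = 0" "g 0 = 0" if "H0_decomposition f h g a b" for h g a b
  proof -
    have "(\<lambda>m. a (m + 2) * 0 ^ (m + 2)) sums (h 0 - 0)" "(\<lambda>m. b (m + 2) * 0 ^ (m + 2)) sums g 0"
      using that unfolding H0_decomposition_def by (meson centre_in_ball zero_less_one)+
    then show "h 0 = 0" "g 0 = 0"
      by (auto simp: sums_iff)
  qed
  have eq: "h z - h' z = cnj (g' z - g z)" if "z \<in> unit_disk" for z
  proof -
    have "h z + cnj (g z) = h' z + cnj (g' z)"
      using 1 2 that by (simp add: H0_decomposition_def)
    then show ?thesis by (simp add: algebra_simps)
  qed
  have hol: "h holomorphic_on unit_disk" "h' holomorphic_on unit_disk"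
    "g holomorphic_on unit_disk" "g' holomorphic_on unit_disk"
    using 1 2 by (auto simp: H0_decomposition_def)
  have const: "k z = k 0" if "k holomorphic_on unit_disk" "\<And>z. z \<in> unit_disk \<Longrightarrow> Im (k z) = 0" for k
    using real_valued_holomorphic_constant[OF that(1) open_ball _ that(2)] z
    by (auto simp: constant_on_def)
  \<comment> \<open>In terms of \<open>w = g' z - g z\<close> these are \<open>2 * Re w\<close> and
    \<open>2 * Im w\<close>, so both are real-valued and hence constant.\<close>
  have "(\<lambda>z. (h z - h' z) + (g' z - g z)) holomorphic_on unit_disk"
    "(\<lambda>z. \<i> * ((h z - h' z) - (g' z - g z))) holomorphic_on unit_disk"
    by (intro holomorphic_intros hol)+
  from const[OF this(1)] const[OF this(2)]
  have "(h z - h' z) + (g' z - g z) = 0" "\<i> * ((h z - h' z) - (g' z - g z)) = 0"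
    using zero[OF 1] zero[OF 2] by (auto simp: eq)
  then have "h z - h' z = 0" "g' z - g z = 0"
    by (auto simp: complex_eq_iff)
  then show "h z = h' z" "g z = g' z" by auto
qed

section \<open>Topology of injective images of the disk\<close>

text \<open>If the limit \<open>w\<close> were attained, the continuous inverse would make
  \<open>\<gamma>\<close> converge to a point inside the disk, not to \<open>l\<close> on the
  circle.\<close>

lemma frontier_image_of_escaping:
  fixes f :: "complex \<Rightarrow> complex"
  assumes cont: "continuous_on unit_disk f" and inj: "inj_on f unit_disk"
    and F: "F \<noteq> bot" "eventually (\<lambda>x. \<gamma> x \<in> unit_disk) F"
    and lim: "(\<gamma> \<longlongrightarrow> l) F" "cmod l = 1" "((\<lambda>x. f (\<gamma> x)) \<longlongrightarrow> w) F"
  shows "w \<in> frontier (f ` unit_disk)"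
proof -
  obtain g where g: "homeomorphism unit_disk (f ` unit_disk) f g"
    using invariance_of_domain_homeomorphism[OF open_ball cont _ inj] by auto
  have op: "open (f ` unit_disk)"
    using invariance_of_domain[OF cont open_ball inj] .
  have "w \<notin> f ` unit_disk"
  proof
    assume w: "w \<in> f ` unit_disk"
    then have "isCont g w"
      using g op by (auto simp: homeomorphism_def continuous_on_eq_continuous_at)
    from isCont_tendsto_compose[OF this lim(3)]
    have "((\<lambda>x. g (f (\<gamma> x))) \<longlongrightarrow> g w) F" .
    moreover have "eventually (\<lambda>x. g (f (\<gamma> x)) = \<gamma> x) F"
      using F(2) by eventually_elim (use g in \<open>auto simp: homeomorphism_def\<close>)
    ultimately have "(\<gamma> \<longlongrightarrow> g w) F"
      by (rule Lim_transform_eventually)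
    then have "g w = l" using lim(1) F(1) tendsto_unique by blast
    moreover have "g w \<in> unit_disk" using g w by (auto simp: homeomorphism_def)
    ultimately show False using lim(2) by simp
  qed
  moreover have "w \<in> closure (f ` unit_disk)"
    by (rule Lim_in_closed_set[OF closed_closure _ F(1) lim(3)])
       (use F(2) closure_subset[of "f ` unit_disk"] in \<open>auto elim!: eventually_mono\<close>)
  ultimately show ?thesis
    using interior_subset by (auto simp: frontier_def)
qed

text \<open>Were the image the whole plane, the preimage of the closed disk of radius
  \<open>B\<close> would be compact in the unit disk, yet it meets every circle of radius below
  1.\<close>

lemma image_disk_neq_UNIV:
  fixes f :: "complex \<Rightarrow> complex"
  assumes cont: "continuous_on unit_disk f" and inj: "inj_on f unit_disk"
    and bd: "\<And>r. 0 < r \<Longrightarrow> r < 1 \<Longrightarrow> \<exists>z. cmod z = r \<and> cmod (f z) \<le> B"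
  shows "f ` unit_disk \<noteq> UNIV"
proof
  assume UN: "f ` unit_disk = UNIV"
  obtain g where g: "homeomorphism unit_disk UNIV f g"
    using invariance_of_domain_homeomorphism[OF open_ball cont _ inj] UN by auto
  have "continuous_on (cball 0 B) g"
    using g by (auto simp: homeomorphism_def intro: continuous_on_subset)
  then have comp: "compact (g ` cball 0 B)"
    by (rule compact_continuous_image) simp
  obtain z0 where z0: "cmod z0 = 1/2" "cmod (f z0) \<le> B" using bd[of "1/2"] by auto
  have "0 \<le> B" using order_trans[OF norm_ge_zero z0(2)] .
  then have "g ` cball 0 B \<noteq> {}" by auto
  then obtain m where m: "m \<in> g ` cball 0 B" "\<And>z. z \<in> g ` cball 0 B \<Longrightarrow> cmod z \<le> cmod m"
    using continuous_attains_sup[OF comp, of cmod] by (auto intro: continuous_intros)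
  have "m \<in> unit_disk" using m(1) g by (auto simp: homeomorphism_def)
  \<comment> \<open>Halfway between the largest modulus \<open>cmod m\<close> in that preimage and
    1.\<close>
  define r where "r = (1 + cmod m) / 2"
  have r: "0 < r" "r < 1" "cmod m < r"
    using \<open>m \<in> unit_disk\<close> norm_ge_zero[of m] by (simp_all add: r_def del: norm_ge_zero)
  obtain z where z: "cmod z = r" "cmod (f z) \<le> B" using bd r by blast
  then have "z \<in> g ` cball 0 B"
    using g r by (auto simp: homeomorphism_def image_iff intro!: bexI[of _ "f z"])
  then show False using m(2)[of z] z r by simp
qed

text \<open>Along the segment with direction \<open>d\<close>, the real part of
  \<open>cnj d * F\<close> has derivative \<open>(cmod d)\<^sup>2 * Re F' > 0\<close>, so it cannot
  return to its initial value.\<close>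

lemma noshiro_warschawski:
  assumes S: "convex S" and z: "z1 \<in> S" "z2 \<in> S" "z1 \<noteq> z2"
    and der: "\<And>z. z \<in> S \<Longrightarrow> (F has_field_derivative F' z) (at z)"
    and pos: "\<And>z. z \<in> S \<Longrightarrow> Re (F' z) > 0"
  shows "F z1 \<noteq> F z2"
proof
  assume eq: "F z1 = F z2"
  define d where "d = z2 - z1"
  define v where "v t = Re (cnj d * F (z1 + of_real t * d))" for t
  have "v 0 < v 1"
  proof (rule DERIV_pos_imp_increasing[where a = 0 and b = 1 and f = v])
    fix t :: real assume t: "0 \<le> t" "t \<le> 1"
    have "z1 + of_real t * d = (1 - t) *\<^sub>R z1 + t *\<^sub>R z2"
      by (simp add: d_def scaleR_conv_of_real algebra_simps)
    also have "\<dots> \<in> S" using S z t by (auto simp: convex_alt)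
    finally have in_S: "z1 + of_real t * d \<in> S" .
    have "((\<lambda>w. z1 + w) has_field_derivative 1) (at (of_real t * d))"
      by (auto intro!: derivative_eq_intros)
    from radial_derivative[OF DERIV_chain2[OF der[OF in_S] this], of "cnj d"]
    have "(v has_real_derivative Re (cnj d * (F' (z1 + of_real t * d) * d))) (at t)"
      unfolding v_def by simp
    moreover have "Re (cnj d * (w * d)) = (cmod d)\<^sup>2 * Re w" for w
      unfolding cmod_power2 by (simp add: power2_eq_square algebra_simps)
    moreover have "(cmod d)\<^sup>2 * Re (F' (z1 + of_real t * d)) > 0"
      using pos[OF in_S] z by (simp add: d_def)
    ultimately show "\<exists>y. (v has_real_derivative y) (at t) \<and> 0 < y"
      by auto
  qed simp
  then show False using eq by (simp add: v_def d_def)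
qed

text \<open>Membership and the coefficients come with separate decompositions; uniqueness of
  \<open>h\<close> and \<open>g\<close> on the disk merges them.\<close>

lemma W0H_E:
  assumes "f \<in> W0H \<mu> \<rho>" and "H0_coefficients f a b"
  obtains h g where "H0_decomposition f h g a b"
    and "\<And>z. z \<in> unit_disk \<Longrightarrow>
      cmod (euler_op \<mu> g z) < Re (euler_op \<mu> h z - of_real \<rho>)"
proof -
  obtain h g a' b' where d: "H0_decomposition f h g a' b'"
    and W: "\<And>z. z \<in> unit_disk \<Longrightarrow> cmod (euler_op \<mu> g z) < Re (euler_op \<mu> h z - of_real \<rho>)"
    using assms(1) by (auto simp: W0H_def)
  obtain h2 g2 where d2: "H0_decomposition f h2 g2 a b"
    using assms(2) by (auto simp: H0_coefficients_def)
  have "H0_decomposition f h g a b"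
    using d d2 H0_decomposition_unique[OF d d2] by (simp add: H0_decomposition_def)
  then show ?thesis using that W by blast
qed

section \<open>Coefficients, growth and injectivity in the harmonic class\<close>

locale W0H_member = bohr_parameters +
  fixes f h g :: "complex \<Rightarrow> complex" and a b :: "nat \<Rightarrow> complex"
  assumes dec: "H0_decomposition f h g a b"
    and W: "\<And>z. z \<in> unit_disk \<Longrightarrow> cmod (euler_op \<mu> g z) < Re (euler_op \<mu> h z - of_real \<rho>)"
begin

lemma decD:
  shows "h holomorphic_on unit_disk" "g holomorphic_on unit_disk"
    "cmod z < 1 \<Longrightarrow> f z = h z + cnj (g z)"
    "cmod z < 1 \<Longrightarrow> (\<lambda>m. a (m + 2) * z ^ (m + 2)) sums (h z - z)"
    "cmod z < 1 \<Longrightarrow> (\<lambda>m. b (m + 2) * z ^ (m + 2)) sums g z"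
  using dec by (auto simp: H0_decomposition_def)

text \<open>Indices 0 and 1 are set by hand, since the decomposition constrains \<open>a\<close> and
  \<open>b\<close> only from 2 on.\<close>

definition rot_coeff :: "complex \<Rightarrow> nat \<Rightarrow> complex" where
  "rot_coeff \<epsilon> n = (if n = 0 then 0 else if n = 1 then 1 else a n + \<epsilon> * b n)"

text \<open>The Euler operator is linear, and \<open>Re (\<epsilon> * w) \<ge> - cmod w\<close>
  turns the harmonic condition into the analytic one.\<close>

lemma in_class_rotation:
  assumes "cmod \<epsilon> = 1"
  shows "in_class (\<lambda>z. h z + \<epsilon> * g z) (rot_coeff \<epsilon>)"
proof -
  have "(\<lambda>n. rot_coeff \<epsilon> n * z ^ n) sums (h z + \<epsilon> * g z) \<and>
      \<rho> < Re (euler_op \<mu> (\<lambda>z. h z + \<epsilon> * g z) z)" if z: "cmod z < 1" for z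
  proof
    have "(\<lambda>m. a (m + 2) * z ^ (m + 2) + \<epsilon> * (b (m + 2) * z ^ (m + 2)))
        sums ((h z - z) + \<epsilon> * g z)"
      using z by (intro sums_add sums_mult decD)
    then have "(\<lambda>m. rot_coeff \<epsilon> (m + 2) * z ^ (m + 2)) sums
        ((h z + \<epsilon> * g z) - (\<Sum>i<2. rot_coeff \<epsilon> i * z ^ i))"
      by (simp add: rot_coeff_def numeral_2_eq_2 algebra_simps)
    then show "(\<lambda>n. rot_coeff \<epsilon> n * z ^ n) sums (h z + \<epsilon> * g z)"
      by (subst (asm) sums_iff_shift) simp
    have fd: "k field_differentiable at w" if "k holomorphic_on unit_disk" "cmod w < 1" for k w
      using that by (auto simp: holomorphic_on_open field_differentiable_def)
    have hol': "deriv h holomorphic_on unit_disk" "deriv g holomorphic_on unit_disk"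
      by (auto intro!: holomorphic_deriv decD)
    have d1: "deriv (\<lambda>z. h z + \<epsilon> * g z) w = deriv h w + \<epsilon> * deriv g w" if "cmod w < 1" for w
      using fd[OF decD(1) that] fd[OF decD(2) that]
      by (simp add: deriv_add deriv_cmult field_differentiable_mult)
    \<comment> \<open>The formula for the first derivative holds near \<open>z\<close>, so it may be
      differentiated again.\<close>
    have "deriv (deriv (\<lambda>z. h z + \<epsilon> * g z)) z = deriv (\<lambda>w. deriv h w + \<epsilon> * deriv g w) z"
      by (rule deriv_cong_ev[OF _ refl])
         (use eventually_nhds_in_open[of unit_disk z] z d1 in \<open>auto elim!: eventually_mono\<close>)
    also have "\<dots> = deriv (deriv h) z + \<epsilon> * deriv (deriv g) z"
      using fd[OF hol'(1) z] fd[OF hol'(2) z]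
      by (simp add: deriv_add deriv_cmult field_differentiable_mult)
    finally have op: "euler_op \<mu> (\<lambda>z. h z + \<epsilon> * g z) z = euler_op \<mu> h z + \<epsilon> * euler_op \<mu> g z"
      using d1[OF z] by (simp add: algebra_simps)
    have "cmod (\<epsilon> * euler_op \<mu> g z) < Re (euler_op \<mu> h z - of_real \<rho>)"
      using W[of z] z assms by (simp add: norm_mult)
    then have "\<rho> < Re (euler_op \<mu> h z) + Re (\<epsilon> * euler_op \<mu> g z)"
      using complex_Re_le_cmod[of "- (\<epsilon> * euler_op \<mu> g z)"] by simp
    then show "\<rho> < Re (euler_op \<mu> (\<lambda>z. h z + \<epsilon> * g z) z)"
      unfolding op by simp
  qed
  then show ?thesis by (auto simp: in_class_def rot_coeff_def)
qed

text \<open>Choosing \<open>\<epsilon>\<close> so that \<open>a n\<close> and \<open>\<epsilon> * b n\<close> point in the same direction turns the bound on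
  \<open>a n + \<epsilon> * b n\<close> into a bound on the sum of the moduli.\<close>

lemma coefficient_bound:
  assumes n: "n \<ge> 2"
  shows "cmod (a n) + cmod (b n) \<le> kappa n"
proof -
  obtain \<alpha> where \<alpha>: "cmod \<alpha> = 1" "a n = of_real (cmod (a n)) * \<alpha>" by (rule complex_polar_direction)
  obtain \<beta> where \<beta>: "cmod \<beta> = 1" "b n = of_real (cmod (b n)) * \<beta>" by (rule complex_polar_direction)
  have nz: "\<beta> \<noteq> 0" using \<beta> by auto
  have "a n + \<alpha> / \<beta> * b n = of_real (cmod (a n) + cmod (b n)) * \<alpha>"
    by (subst \<alpha>(2), subst \<beta>(2)) (use nz in \<open>simp add: field_simps\<close>)
  then have "cmod (a n + \<alpha> / \<beta> * b n) = cmod (a n) + cmod (b n)"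
    using \<alpha> by (simp add: norm_mult del: of_real_add)
  moreover have "cmod (\<alpha> / \<beta>) = 1" using \<alpha> \<beta> by (simp add: norm_divide)
  ultimately show ?thesis
    using in_class_coeff_bound[OF in_class_rotation n, of "\<alpha> / \<beta>"] n by (simp add: rot_coeff_def)
qed

lemma growth_le:
  assumes z: "cmod z < 1"
  shows "growth (cmod z) \<le> cmod (h z) - cmod (g z)"
proof -
  obtain \<zeta> where \<zeta>: "cmod \<zeta> = 1" "z = of_real (cmod z) * \<zeta>" by (rule complex_polar_direction)
  obtain \<beta> where \<beta>: "cmod \<beta> = 1" "g z = of_real (cmod (g z)) * \<beta>" by (rule complex_polar_direction)
  \<comment> \<open>This makes \<open>\<epsilon> * g z\<close> point opposite to \<open>z\<close>,
    so that the growth bound loses exactly \<open>cmod (g z)\<close>.\<close>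
  define \<epsilon> where "\<epsilon> = - \<zeta> / \<beta>"
  have "\<beta> \<noteq> 0" using \<beta> by auto
  then have eg: "\<epsilon> * g z = - (of_real (cmod (g z)) * \<zeta>)"
    by (subst \<beta>(2)) (simp add: \<epsilon>_def)
  have cz: "cnj \<zeta> * \<zeta> = 1"
    using \<zeta> complex_norm_square[of \<zeta>] by (simp add: mult.commute)
  have "cmod \<epsilon> = 1" using \<zeta> \<beta> by (simp add: \<epsilon>_def norm_divide)
  from in_class_growth[OF in_class_rotation[OF this] \<zeta>(1), of "cmod z"]
  have "growth (cmod z) \<le> Re (cnj \<zeta> * (h z + \<epsilon> * g z))"
    using z \<zeta>(2) by (simp add: growth_eq_extremal)
  also have "cnj \<zeta> * (h z + \<epsilon> * g z) = cnj \<zeta> * h z - of_real (cmod (g z)) * (cnj \<zeta> * \<zeta>)"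
    unfolding eg by (simp add: algebra_simps)
  also have "Re \<dots> = Re (cnj \<zeta> * h z) - cmod (g z)"
    unfolding cz by simp
  also have "Re (cnj \<zeta> * h z) \<le> cmod (h z)"
    using complex_Re_le_cmod[of "cnj \<zeta> * h z"] \<zeta> by (simp add: norm_mult)
  finally show ?thesis by simp
qed

lemma growth_le_f: "cmod z < 1 \<Longrightarrow> growth (cmod z) \<le> cmod (f z)"
  using growth_le[of z] norm_diff_ineq[of "h z" "cnj (g z)"] by (simp add: decD(3))

text \<open>A collision \<open>f z1 = f z2\<close> is a collision of \<open>h + \<epsilon> g\<close> for a suitable unimodular \<open>\<epsilon>\<close>.\<close>

lemma f_inj: "inj_on f unit_disk"
proof (rule inj_onI, rule ccontr)
  fix z1 z2 assume z: "z1 \<in> unit_disk" "z2 \<in> unit_disk" and eq: "f z1 = f z2" and ne: "z1 \<noteq> z2"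
  define G where "G = g z1 - g z2"
  have hG: "h z1 - h z2 = - cnj G"
    using eq z by (simp add: decD G_def algebra_simps)
  obtain \<beta> where \<beta>: "cmod \<beta> = 1" "G = of_real (cmod G) * \<beta>" by (rule complex_polar_direction)
  define \<epsilon> where "\<epsilon> = cnj \<beta> / \<beta>"
  have \<epsilon>: "cmod \<epsilon> = 1" "\<beta> \<noteq> 0" using \<beta> by (auto simp: \<epsilon>_def norm_divide)
  have "\<epsilon> * G = cnj G"
    by (subst (1 2) \<beta>(2)) (use \<epsilon> in \<open>simp add: \<epsilon>_def\<close>)
  then have "(h z1 - h z2) + \<epsilon> * G = 0"
    unfolding hG by simp
  then have "h z1 + \<epsilon> * g z1 = h z2 + \<epsilon> * g z2"
    by (simp add: G_def algebra_simps)
  moreover have "h z1 + \<epsilon> * g z1 \<noteq> h z2 + \<epsilon> * g z2"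
    by (rule noshiro_warschawski[OF convex_ball z ne in_class_derivatives(1) in_class_deriv_pos])
       (use in_class_rotation[OF \<epsilon>(1)] in auto)
  ultimately show False by simp
qed

lemma f_cont: "continuous_on unit_disk f"
proof -
  have "continuous_on unit_disk (\<lambda>z. h z + cnj (g z))"
    by (intro continuous_intros holomorphic_on_imp_continuous_on decD)
  then show ?thesis by (rule continuous_on_cong[THEN iffD1, rotated 2]) (auto simp: decD)
qed

text \<open>Since \<open>h z / z\<close> has no zeros and equals \<open>1\<close> at the origin, this is the minimum modulus
  principle. It excludes \<open>f ` unit_disk = UNIV\<close>, for which \<^const>\<open>infdist\<close> to the empty frontier
  would be \<open>0\<close>.\<close>

lemma h_bounded_somewhere:
  assumes r: "0 < r" "r < 1"
  shows "\<exists>z. cmod z = r \<and> cmod (h z) \<le> 1"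
proof (rule ccontr)
  assume "\<not> ?thesis"
  then have big: "cmod (h z) > 1" if "cmod z = r" for z using that by force
  \<comment> \<open>The coefficients of \<open>h z / z\<close>, so that \<open>\<psi>\<close>
    extends this quotient to the origin.\<close>
  define c where "c n = (if n = 0 then 1 else a (Suc n))" for n
  define \<psi> where "\<psi> z = (\<Sum>n. c n * z ^ n)" for z
  have cs: "(\<lambda>n. c n * z ^ n) sums \<psi> z \<and> z * \<psi> z = h z" if z: "cmod z < 1" for z
  proof (cases "z = 0")
    case True
    have "h 0 = 0" using decD(4)[of 0] by (auto simp: sums_iff)
    have "(\<lambda>n. c n * 0 ^ n) sums c 0" by simp
    then show ?thesis using True \<open>h 0 = 0\<close> by (auto simp: \<psi>_def sums_iff)
  next
    case False
    from sums_mult[OF decD(4)[OF z], of "1 / z"]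
    have "(\<lambda>m. c (Suc m) * z ^ Suc m) sums (h z / z - 1)"
      using False by (simp add: c_def field_simps)
    then have "(\<lambda>n. c n * z ^ n) sums (h z / z)"
      by (subst (asm) sums_Suc_iff) (simp add: c_def)
    then show ?thesis using False by (auto simp: \<psi>_def sums_iff)
  qed
  have hol: "\<psi> holomorphic_on unit_disk"
    by (rule power_series_holomorphic[of c]) (use cs in blast)
  have \<psi>0: "\<psi> 0 = 1"
  proof -
    have "(\<lambda>n. c n * 0 ^ n) sums c 0" by simp
    then show ?thesis by (simp add: \<psi>_def sums_iff c_def)
  qed
  have nz: "\<psi> z \<noteq> 0" if z: "cmod z < 1" for z
  proof (cases "z = 0")
    case False
    then have "0 < cmod z" by simp
    from growth_pos[OF this z] growth_le[OF z] norm_ge_zero[of "g z"]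
    have "cmod (h z) > 0" by linarith
    then show ?thesis using cs[OF z] by auto
  qed (simp add: \<psi>0)
  have sub: "cball 0 r \<subseteq> unit_disk" using r by auto
  have hol': "(\<lambda>z. 1 / \<psi> z) holomorphic_on unit_disk"
    by (intro holomorphic_intros hol) (use nz in auto)
  \<comment> \<open>On the circle \<open>cmod (h z) > 1\<close> gives
    \<open>cmod (1 / \<psi> z) \<le> r\<close>; the maximum principle carries this to the centre,
    where the value is \<open>1 > r\<close>.\<close>
  have "cmod (1 / \<psi> 0) \<le> r"
  proof (rule maximum_modulus_frontier[where f = "\<lambda>z. 1 / \<psi> z" and S = "cball 0 r"])
    show "(\<lambda>z. 1 / \<psi> z) holomorphic_on interior (cball 0 r)"
      by (rule holomorphic_on_subset[OF hol']) (use sub interior_subset in blast)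
    show "continuous_on (closure (cball 0 r)) (\<lambda>z. 1 / \<psi> z)"
      using holomorphic_on_imp_continuous_on[OF hol'] sub by (auto intro: continuous_on_subset)
    fix z :: complex assume "z \<in> frontier (cball 0 r)"
    then have z: "cmod z = r" using r by (simp add: dist_norm)
    have "z * \<psi> z = h z" using cs[of z] z r by simp
    then have "r * cmod (\<psi> z) = cmod (h z)" using z by (metis norm_mult)
    then have "1 \<le> r * cmod (\<psi> z)" using big[OF z] by simp
    then show "cmod (1 / \<psi> z) \<le> r"
      using nz[of z] z r by (simp add: norm_divide divide_simps)
  qed (use r in auto)
  then show False using r \<psi>0 by simp
qed

lemma frontier_nonempty: "frontier (f ` unit_disk) \<noteq> {}"
proof -
  have "f ` unit_disk \<noteq> UNIV"
  proof (rule image_disk_neq_UNIV[OF f_cont f_inj, of 2])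
    fix r :: real assume r: "0 < r" "r < 1"
    then obtain z where z: "cmod z = r" "cmod (h z) \<le> 1" using h_bounded_somewhere by blast
    have "cmod (g z) \<le> cmod (h z)"
      using growth_le[of z] growth_pos[of r] z r by simp
    then have "cmod (f z) \<le> 2"
      using z r norm_triangle_ineq[of "h z" "cnj (g z)"] by (simp add: decD(3))
    then show "\<exists>z. cmod z = r \<and> cmod (f z) \<le> 2" using z by blast
  qed
  then show ?thesis
    using frontier_eq_empty[of "f ` unit_disk"] by auto
qed

lemma f_0: "f 0 = 0"
  using decD(3,4,5)[of 0] by (auto simp: sums_iff)

text \<open>The image lies in the closed set \<open>K\<close>, the image of a smaller closed disk
  together with the exterior of a disk of radius \<open>growth r\<close>. A frontier point is not in
  the open image, so it lies in the exterior; then \<open>r\<close> tends to 1.\<close>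

lemma frontier_ge:
  assumes w: "w \<in> frontier (f ` unit_disk)"
  shows "growth 1 \<le> cmod w"
proof -
  have "open (f ` unit_disk)" by (rule invariance_of_domain[OF f_cont open_ball f_inj])
  then have w': "w \<in> closure (f ` unit_disk)" "w \<notin> f ` unit_disk"
    using w by (auto simp: frontier_def interior_open)
  have "growth r \<le> cmod w" if r: "0 < r" "r < 1" for r
  proof -
    define K where "K = f ` cball 0 r \<union> {v. growth r \<le> cmod v}"
    have "compact (f ` cball 0 r)"
      by (rule compact_continuous_image[OF continuous_on_subset[OF f_cont]]) (use r in auto)
    then have "closed K"
      unfolding K_def by (intro closed_Un closed_Collect_le continuous_intros compact_imp_closed)
    moreover have "f ` unit_disk \<subseteq> K"
    proof
      fix v assume "v \<in> f ` unit_disk"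
      then obtain z where z: "cmod z < 1" "v = f z" by auto
      show "v \<in> K"
      proof (cases "cmod z \<le> r")
        case False
        then have "growth r < growth (cmod z)" using z r by (intro growth_strict_mono) auto
        then show ?thesis using growth_le_f[OF z(1)] z by (simp add: K_def)
      qed (use z in \<open>auto simp: K_def\<close>)
    qed
    ultimately have "w \<in> K" using w'(1) closure_minimal by blast
    moreover have "f ` cball 0 r \<subseteq> f ` unit_disk" using r by auto
    ultimately show ?thesis using w'(2) by (auto simp: K_def)
  qed
  then have "eventually (\<lambda>r. growth r \<le> cmod w) (at_left 1)"
    by (intro eventually_at_leftI[of 0]) auto
  then show ?thesis
    by (rule tendsto_upperbound[OF growth_tendsto]) simp
qed

lemma infdist_ge: "growth 1 \<le> infdist (f 0) (frontier (f ` unit_disk))"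
  unfolding infdist_notempty[OF frontier_nonempty] f_0
  by (rule cINF_greatest[OF frontier_nonempty]) (use frontier_ge in \<open>simp add: dist_norm\<close>)

end

section \<open>The Bohr radius\<close>

context bohr_parameters begin

text \<open>The left-hand side of the radius equation, which is also the extremal function on the
  positive radius, as its coefficients are nonnegative.\<close>

definition majorant :: "real \<Rightarrow> real" where
  "majorant r = r + (\<Sum>m. kappa (m + 2) * r ^ (m + 2))"

text \<open>The exponent \<open>m + 2 - 1\<close> flips the sign of \<open>(-1) ^ m\<close>, whence
  the factor -2. Pulling it out of \<open>suminf\<close> needs summability, which the Leibniz
  criterion supplies even for \<open>\<mu> = 0\<close>.\<close>

lemma bohr_equation_iff: "bohr_equation \<mu> \<rho> r \<longleftrightarrow> majorant r = growth 1"
proof -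
  have "(\<Sum>m. (-1) ^ m * kappa (m + 2)) =
      (\<Sum>m. (-2) * ((-1) ^ (m + 2 - 1) * (1 - \<rho>) / (real (m + 2) * (1 + \<mu> * (real (m + 2) - 1)))))"
    by (intro arg_cong[of _ _ suminf] ext) (simp add: kappa_def)
  moreover have "summable (\<lambda>m. (-1) ^ m * kappa (m + 2))"
    using growth_bounds(3)[of 1] by simp
  then have "summable (\<lambda>m. (-1/2) * ((-1) ^ m * kappa (m + 2)))"
    by (rule summable_mult)
  then have "summable (\<lambda>m. (-1) ^ (m + 2 - 1) * (1 - \<rho>) / (real (m + 2) * (1 + \<mu> * (real (m + 2) - 1))))"
    by (rule back_subst[of summable]) (simp add: kappa_def fun_eq_iff del: right_diff_distrib_numeral)
  ultimately have "growth 1 = 1 + 2 * (\<Sum>m. (-1) ^ (m + 2 - 1) * (1 - \<rho>) /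
      (real (m + 2) * (1 + \<mu> * (real (m + 2) - 1))))"
    unfolding growth_def by (subst (asm) suminf_mult) auto
  then show ?thesis
    unfolding bohr_equation_def majorant_def kappa_def by simp
qed

lemma kappa_summable:
  assumes "\<bar>r\<bar> < 1"
  shows "summable (\<lambda>m. kappa (m + 2) * r ^ (m + 2))"
  using summable_ignore_initial_segment[OF ext_coeff_summable[OF assms], of 2]
  by (simp add: ext_coeff_def)

lemma majorant_strict_mono:
  assumes "0 \<le> r" "r < s" "s < 1"
  shows "majorant r < majorant s"
proof -
  have "(\<Sum>m. kappa (m + 2) * r ^ (m + 2)) \<le> (\<Sum>m. kappa (m + 2) * s ^ (m + 2))"
    using assms by (intro suminf_le kappa_summable mult_left_mono power_mono
        less_imp_le[OF kappa_pos]) auto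
  then show ?thesis using assms by (simp add: majorant_def)
qed

lemma majorant_eq: "\<bar>r\<bar> < 1 \<Longrightarrow> majorant r = (\<Sum>n. ext_coeff n * r ^ n)"
  using suminf_split_initial_segment[OF ext_coeff_summable, of r 2]
  by (simp add: majorant_def ext_coeff_def numeral_2_eq_2)

lemma majorant_continuous:
  assumes "0 \<le> s" "s < 1"
  shows "continuous_on {0..s} majorant"
proof -
  \<comment> \<open>A radius of convergence strictly beyond \<open>s\<close> gives continuity at
    \<open>s\<close> too.\<close>
  obtain K where K: "s < K" "K < 1" using assms dense by blast
  have "continuous_on {0..s} (\<lambda>r. \<Sum>n. ext_coeff n * r ^ n)"
    using assms K
    by (intro continuous_at_imp_continuous_on ballI isCont_powser[of _ K] ext_coeff_summable) auto
  then show ?thesis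
    by (rule continuous_on_cong[THEN iffD1, rotated 2]) (use assms majorant_eq in auto)
qed

lemma majorant_root: "\<exists>!r. r \<in> {0<..<1} \<and> majorant r = growth 1"
proof -
  \<comment> \<open>Since \<open>majorant s \<ge> s > growth 1\<close>, the root lies below
    \<open>s\<close>; staying below 1 avoids the divergence at 1 when
    \<open>\<mu> = 0\<close>.\<close>
  define s where "s = (1 + growth 1) / 2"
  have s: "0 < s" "s < 1" "growth 1 < s" using growth_1_bounds by (auto simp: s_def)
  have "0 \<le> (\<Sum>m. kappa (m + 2) * s ^ (m + 2))"
    using s by (intro suminf_nonneg kappa_summable mult_nonneg_nonneg less_imp_le[OF kappa_pos]) auto
  then have "growth 1 \<le> majorant s" using s by (simp add: majorant_def)
  moreover have m0: "majorant 0 = 0" by (simp add: majorant_def)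
  ultimately obtain r where r: "0 \<le> r" "r \<le> s" "majorant r = growth 1"
    using IVT'[of majorant 0 "growth 1" s] growth_1_bounds s majorant_continuous[of s] by auto
  have "r \<noteq> 0" using r m0 growth_1_bounds by auto
  show ?thesis
  proof (rule ex1I)
    show "r \<in> {0<..<1} \<and> majorant r = growth 1" using r s \<open>r \<noteq> 0\<close> by auto
    fix t assume t: "t \<in> {0<..<1} \<and> majorant t = growth 1"
    show "t = r"
      using majorant_strict_mono[of t r] majorant_strict_mono[of r t] t r s
      by (cases t r rule: linorder_cases) auto
  qed
qed

section \<open>The Bohr inequality and its sharpness\<close>

text \<open>The coefficient bound places the sum below \<open>majorant r = growth 1\<close>, which
  is at most the distance to the boundary.\<close>

lemma bohr_inequality_member:
  assumes f: "f \<in> W0H \<mu> \<rho>" "H0_coefficients f a b" and r: "majorant r = growth 1" "r < 1"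
    and z: "cmod z \<le> r"
  shows "bohr_inequality f a b z"
proof -
  obtain h g where hg: "H0_decomposition f h g a b"
    "\<And>z. z \<in> unit_disk \<Longrightarrow> cmod (euler_op \<mu> g z) < Re (euler_op \<mu> h z - of_real \<rho>)"
    using W0H_E[OF f] by blast
  interpret W0H_member \<mu> \<rho> f h g a b
    by unfold_locales (use hg in auto)
  define s where "s = cmod z"
  have s: "0 \<le> s" "s \<le> r" "s < 1" using z r by (auto simp: s_def)
  have le: "(cmod (a (m + 2)) + cmod (b (m + 2))) * s ^ (m + 2) \<le> kappa (m + 2) * s ^ (m + 2)" for m
    using s by (intro mult_right_mono coefficient_bound) auto
  have ks: "summable (\<lambda>m. kappa (m + 2) * s ^ (m + 2))" using s by (intro kappa_summable) auto
  have sm: "summable (\<lambda>m. (cmod (a (m + 2)) + cmod (b (m + 2))) * s ^ (m + 2))"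
    by (rule summable_comparison_test'[OF ks]) (use le s in auto)
  have "s + (\<Sum>m. (cmod (a (m + 2)) + cmod (b (m + 2))) * s ^ (m + 2)) \<le> majorant s"
    unfolding majorant_def using le by (intro add_left_mono suminf_le sm ks)
  also have "\<dots> \<le> majorant r"
    using majorant_strict_mono[of s r] s r by (cases "s = r") auto
  finally show ?thesis
    using sm infdist_ge r by (simp add: bohr_inequality_def s_def)
qed

lemma extremal_decomposition:
  "H0_decomposition extremal extremal (\<lambda>_. 0) (\<lambda>n. of_real (kappa n)) (\<lambda>_. 0)"
proof -
  have "(\<lambda>m. of_real (kappa (m + 2)) * z ^ (m + 2)) sums (extremal z - z)" if "cmod z < 1" for z
    using sums_split_initial_segment[OF extremal_sums[OF that], of 2]
    by (simp add: ext_coeff_def numeral_2_eq_2)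
  moreover have "extremal holomorphic_on unit_disk"
    by (rule power_series_holomorphic[OF extremal_sums])
  ultimately show ?thesis by (auto simp: H0_decomposition_def)
qed

lemma extremal_condition:
  assumes "z \<in> unit_disk"
  shows "cmod (euler_op \<mu> (\<lambda>_. 0) z) < Re (euler_op \<mu> extremal z - of_real \<rho>)"
  using in_classD(4)[OF in_class_extremal, of z] assms by simp

lemma extremal_in_W0H: "extremal \<in> W0H \<mu> \<rho>"
  unfolding W0H_def using extremal_decomposition extremal_condition by blast

text \<open>The values on the negative radius tend to \<open>- growth 1\<close>, which is therefore
  a frontier point.\<close>

lemma extremal_infdist: "infdist (extremal 0) (frontier (extremal ` unit_disk)) \<le> growth 1"
proof -
  interpret W0H_member \<mu> \<rho> extremal extremal "\<lambda>_. 0" "\<lambda>n. of_real (kappa n)" "\<lambda>_. 0"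
    by unfold_locales (use extremal_decomposition extremal_condition in auto)
  have "of_real (- growth 1) \<in> frontier (extremal ` unit_disk)"
  proof (rule frontier_image_of_escaping[OF f_cont f_inj, of "at_left 1" "\<lambda>r. - of_real r" "-1"])
    show "eventually (\<lambda>r. - complex_of_real r \<in> unit_disk) (at_left 1)"
      by (rule eventually_at_leftI[of 0]) auto
    have "((\<lambda>r. - complex_of_real r) \<longlongrightarrow> - of_real 1) (at_left 1)"
      by (intro tendsto_intros)
    then show "((\<lambda>r. - complex_of_real r) \<longlongrightarrow> -1) (at_left 1)" by simp
    have "((\<lambda>r. complex_of_real (- growth r)) \<longlongrightarrow> of_real (- growth 1)) (at_left 1)"
      by (intro tendsto_intros growth_tendsto)
    moreover have "eventually (\<lambda>r. complex_of_real (- growth r) = extremal (- of_real r)) (at_left 1)"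
      by (rule eventually_at_leftI[of 0]) (auto simp: growth_eq_extremal)
    ultimately show "((\<lambda>r. extremal (- of_real r)) \<longlongrightarrow> of_real (- growth 1)) (at_left 1)"
      by (rule Lim_transform_eventually)
  qed auto
  from infdist_le[OF this, of 0] show ?thesis
    using growth_1_bounds f_0 by (simp add: dist_norm)
qed

lemma bohr_radius_le:
  assumes r: "majorant r = growth 1" "0 < r" "r < 1"
    and R: "R \<in> {0<..1}" "bohr_inequality_upto (W0H \<mu> \<rho>) R"
  shows "R \<le> r"
proof (rule ccontr)
  assume "\<not> R \<le> r"
  \<comment> \<open>As \<open>R \<le> 1\<close>, this \<open>t\<close> lies below 1, where the
    majorant series converges and is strictly increasing.\<close>
  then obtain t where t: "r < t" "t < R" using dense by (meson not_le)
  have t1: "0 < t" "t < 1" using t r R by auto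
  have "H0_coefficients extremal (\<lambda>n. of_real (kappa n)) (\<lambda>_. 0)"
    using extremal_decomposition by (auto simp: H0_coefficients_def)
  then have "bohr_inequality extremal (\<lambda>n. of_real (kappa n)) (\<lambda>_. 0) (of_real t)"
    using R extremal_in_W0H t t1 by (auto simp: bohr_inequality_upto_def)
  then have "t + (\<Sum>m. cmod (of_real (kappa (m + 2))) * t ^ (m + 2)) \<le> growth 1"
    using extremal_infdist t1 by (simp add: bohr_inequality_def)
  moreover have "cmod (of_real (kappa (m + 2))) = kappa (m + 2)" for m
    using kappa_pos[of "m + 2"] by (simp add: abs_of_pos)
  ultimately have "majorant t \<le> growth 1" by (simp add: majorant_def)
  then show False using majorant_strict_mono[of r t] t t1 r by simp
qed

end

theorem theorem3p1:
  fixes \<mu> \<rho> :: real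
  assumes "0 \<le> \<mu>" and "0 \<le> \<rho>" and "\<rho> < 1"
  shows "(\<exists>!r. r \<in> {0<..<1} \<and> bohr_equation \<mu> \<rho> r) \<and>
    (\<forall>rs\<in>{0<..<1}. bohr_equation \<mu> \<rho> rs \<longrightarrow>
       (\<forall>f\<in>W0H \<mu> \<rho>. \<forall>a b z. H0_coefficients f a b \<longrightarrow> cmod z \<le> rs \<longrightarrow>
          bohr_inequality f a b z) \<and>
       is_bohr_radius (W0H \<mu> \<rho>) rs)"
proof -
  interpret bohr_parameters \<mu> \<rho> by unfold_locales (use assms in auto)
  show ?thesis
    unfolding bohr_equation_iff is_bohr_radius_def
    using majorant_root bohr_inequality_member bohr_radius_le
    by (auto simp: bohr_inequality_upto_def)
qed

end
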